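(* Let $F=F(m,k_1,\ldots,k_\nu)$ be a summand of the colored Jones polynomial $J_n(K;q)$ of a knot $K$ ($n=2m+1$), of the form described in the context, and let $\Phi_F(\alpha,w_1,\ldots,w_\nu)$ be its potential function. Then the system of equations $$\exp\left(w_j\frac{\partial \Phi_F}{\partial w_j}\right)=1\quad (j=1,\ldots,\nu),\qquad \exp\left(\alpha\frac{\partial \Phi_F}{\partial \alpha}\right)=l^2$$ coincides with the system $$\varepsilon\left.\frac{E_jF}{F}\right|_{q^{k_i}=Q_i,\ q^m=Q_{(0)}}=1\quad (j=1,\ldots,\nu),\qquad \varepsilon\left.\frac{E_{(0)}F}{F}\right|_{q^{k_i}=Q_i,\ q^m=Q_{(0)}}=E^2,$$ under the correspondences $w_j=Q_j$ ($j=1,\ldots,\nu$), $\alpha=Q_{(0)}$ and $l=E$.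
   Context: **The summand.** $J_n(K;q)$ is the $n$-th colored Jones polynomial of $K$, normalized by $J_n(\text{unknot};q)=[n]=\frac{q^{n/2}-q^{-n/2}}{q^{1/2}-q^{-1/2}}$. Here $n$ is an integer and $m$ is the half-integer with $n=2m+1$. A summand is a function $F$ with $J_n(K;q)=\sum_{k_1,\ldots,k_\nu}F(m,k_1,\ldots,k_\nu)$ of the form $$F(m,k_1,\ldots,k_\nu)=(-1)^{(e,\tilde k)}\,q^{\frac12\tilde k^\top A\tilde k+(b,\tilde k)+c}\,\frac{\prod_s (q)_{(p_s,\tilde k)+r_s}}{\prod_t (q)_{(p'_t,\tilde k)+r'_t}},$$ where $\tilde k=(m,k_1,\ldots,k_\nu)$ (we also write $k_0=m$), $(\cdot,\cdot)$ is the standard inner product, $e=(e_0,\ldots,e_\nu)\in\{0,1\}^{\nu+1}$, $A=(a_{ij})_{0\le i,j\le\nu}$ is a symmetric integer matrix, $b\in\mathbb{Q}^{\nu+1}$, $c\in\mathbb{Z}$, $p_s,p'_t\in\mathbb{Z}^{\nu+1}$, $r_s,r'_t\in\mathbb{Z}$, the products are finite, and $(q)_k=(1-q)(1-q^2)\cdots(1-q^k)$. The function $F$ is $q$-hypergeometric: the ratios $E_jF/F$ and $E_{(0)}F/F$ below are rational functions of $q,q^m,q^{k_1},\ldots,q^{k_\nu}$ (computed formally using $(q)_{k+1}/(q)_k=1-q^{k+1}$). **The potential function.** With $w_0=\alpha$ and $\tilde w^{p}=\alpha^{p_0}w_1^{p_1}\cdots w_\nu^{p_\nu}$ for $p=(p_0,\ldots,p_\nu)$,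 the potential function of $F$ is $$\Phi_F(\alpha,w_1,\ldots,w_\nu)=\pi\sqrt{-1}\sum_{i=0}^\nu e_i\log w_i+\frac12\sum_{i,j=0}^\nu a_{ij}\log w_i\log w_j+\sum_s\left(-\mathrm{Li}_2(\tilde w^{p_s})+\frac{\pi^2}{6}\right)-\sum_t\left(-\mathrm{Li}_2(\tilde w^{p'_t})+\frac{\pi^2}{6}\right),$$ where $\mathrm{Li}_2(z)=-\int_0^z\frac{\log(1-x)}{x}dx$. **Operators.** $(E_{(0)}F)(m,k_1,\ldots,k_\nu)=F(m+1,k_1,\ldots,k_\nu)$ and $(E_jF)(m,k_1,\ldots,k_j,\ldots,k_\nu)=F(m,k_1,\ldots,k_j+1,\ldots,k_\nu)$. The operator $E$ shifts $n$ to $n+1$ (i.e. $m$ to $m+\frac12$), so $E_{(0)}=E^2$. The operators $Q_{(0)}$ and $Q_j$ are multiplication by $q^m$ and $q^{k_j}$. The notation $|_{q^{k_i}=Q_i,\ q^m=Q_{(0)}}$ means that $q^{k_i}$ and $q^m$ in the ratio are replaced by the symbols $Q_i$ and $Q_{(0)}$. Then $\varepsilon$ denotes evaluation at $q=1$, with $Q_{(0)},Q_1,\ldots,Q_\nu$ regarded as independent commuting variables; in the resulting equations $E$ is likewise regarded as a commuting variable. *)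

theory Defs
  imports "HOL-Complex_Analysis.Complex_Analysis"
begin

text \<open>
  Fractional powers of \<open>q\<close> occur throughout. We write \<open>q = exp h\<close> and read \<open>q ^ x\<close> as \<open>exp (h * x)\<close>;
  an identity in fractional powers of the indeterminate \<open>q\<close> becomes an identity valid for all
  \<open>h\<close> such that \<open>q\<close> is not a root of unity, and \<open>q = 1\<close> is \<open>h = 0\<close>.
\<close>

definition qpow :: "complex \<Rightarrow> complex \<Rightarrow> complex" where
  "qpow h x = exp (h * x)"

definition generic_q :: "complex \<Rightarrow> bool" where
  "generic_q h \<longleftrightarrow> (\<forall>n::nat. n > 0 \<longrightarrow> qpow h (of_nat n) \<noteq> 1)"


section \<open>The colored Jones polynomial\<close>

text \<open>
  A knot is presented as the closure of a braid: the number of strands, and a word of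
  letters \<open>(p, s)\<close>, where \<open>(p, True)\<close> is the generator crossing the strands \<open>p\<close> and \<open>p + 1\<close>
  (counted from \<open>0\<close>) and \<open>(p, False)\<close> is its inverse. By Alexander's theorem every knot arises.
\<close>

type_synonym braid = "nat \<times> (nat \<times> bool) list"

definition braid_perm :: "(nat \<times> bool) list \<Rightarrow> nat \<Rightarrow> nat" where
  "braid_perm u = foldr (\<lambda>(p, s) f. Transposition.transpose p (p + 1) \<circ> f) u id"

definition is_knot :: "braid \<Rightarrow> bool" where
  "is_knot K \<longleftrightarrow> (case K of (d, u) \<Rightarrow>
     d > 0 \<and> (\<forall>(p, s) \<in> set u. p + 1 < d) \<and>
     (\<forall>x<d. \<exists>n. (braid_perm u ^^ n) 0 = x))"

definition qbr :: "complex \<Rightarrow> nat \<Rightarrow> complex" where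
  "qbr h n = qpow h (of_nat n / 2) - qpow h (- of_nat n / 2)"

definition qbr_fact :: "complex \<Rightarrow> nat \<Rightarrow> complex" where
  "qbr_fact h n = (\<Prod>i=1..n. qbr h i)"

text \<open>
  The R-matrix of the \<open>N\<close>-dimensional irreducible representation of quantum \<open>sl\<^sub>2\<close> and its inverse;
  \<open>Rpos h N i j k l\<close> is the coefficient of \<open>e\<^sub>i \<otimes> e\<^sub>j\<close> in the image of \<open>e\<^sub>k \<otimes> e\<^sub>l\<close>, where all
  indices lie in \<open>{0..<N}\<close>. With \<open>{n} = qbr h n\<close> and \<open>{n}! = qbr_fact h n\<close>, in the positive case
    \<open>{l}! {N-1-k}! / ({i}! {n}! {N-1-j}!) q ^ ((i - (N-1)/2) (j - (N-1)/2) - n (i-j)/2 - n (n+1)/4)\<close>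
  for \<open>l = i + n\<close>, \<open>k = j - n\<close>, \<open>n \<ge> 0\<close>, and \<open>0\<close> otherwise.
\<close>

definition Rpos :: "complex \<Rightarrow> nat \<Rightarrow> nat \<Rightarrow> nat \<Rightarrow> nat \<Rightarrow> nat \<Rightarrow> complex" where
  "Rpos h N i j k l =
     (if i \<le> l \<and> k + l = i + j then
        let n = l - i;
            i' = of_nat i - (of_nat N - 1) / 2;
            j' = of_nat j - (of_nat N - 1) / 2
        in qbr_fact h l * qbr_fact h (N - 1 - k)
             / (qbr_fact h i * qbr_fact h n * qbr_fact h (N - 1 - j))
           * qpow h (i' * j' - of_nat n * (of_nat i - of_nat j) / 2 - of_nat (n * (n + 1)) / 4)
      else 0)"

definition Rneg :: "complex \<Rightarrow> nat \<Rightarrow> nat \<Rightarrow> nat \<Rightarrow> nat \<Rightarrow> nat \<Rightarrow> complex" where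
  "Rneg h N i j k l =
     (if l \<le> i \<and> k + l = i + j then
        let n = i - l;
            i' = of_nat i - (of_nat N - 1) / 2;
            j' = of_nat j - (of_nat N - 1) / 2
        in qbr_fact h k * qbr_fact h (N - 1 - l)
             / (qbr_fact h j * qbr_fact h n * qbr_fact h (N - 1 - i))
           * (-1) ^ n
           * qpow h (- i' * j' - of_nat n * (of_nat i - of_nat j) / 2 + of_nat (n * (n + 1)) / 4)
      else 0)"

text \<open>A basis vector of the \<open>d\<close>-th tensor power is a list of \<open>d\<close> indices below \<open>N\<close>.\<close>

definition basis_states :: "nat \<Rightarrow> nat \<Rightarrow> nat list set" where
  "basis_states N d = {x. length x = d \<and> set x \<subseteq> {..<N}}"

definition gen_mat :: "complex \<Rightarrow> nat \<Rightarrow> nat \<times> bool \<Rightarrow> nat list \<Rightarrow> nat list \<Rightarrow> complex" where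
  "gen_mat h N g x y = (case g of (p, s) \<Rightarrow>
     if take p x = take p y \<and> drop (p + 2) x = drop (p + 2) y
     then (if s then Rpos else Rneg) h N (x ! p) (x ! (p + 1)) (y ! p) (y ! (p + 1))
     else 0)"

primrec braid_mat ::
  "complex \<Rightarrow> nat \<Rightarrow> nat \<Rightarrow> (nat \<times> bool) list \<Rightarrow> nat list \<Rightarrow> nat list \<Rightarrow> complex" where
  "braid_mat h N d [] x y = (if x = y then 1 else 0)"
| "braid_mat h N d (g # u) x y =
     (\<Sum>z\<in>basis_states N d. gen_mat h N g x z * braid_mat h N d u z y)"

definition writhe :: "(nat \<times> bool) list \<Rightarrow> int" where
  "writhe u = (\<Sum>(p, s)\<leftarrow>u. if s then 1 else - 1)"

text \<open>
  \<open>J\<^sub>N(K; q)\<close> as the framing-corrected quantum trace of the braid; for the one-strand trivial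
  braid it is \<open>\<Sum>i<N. q ^ (i - (N-1)/2) = [N]\<close>.
\<close>

definition colored_jones :: "braid \<Rightarrow> nat \<Rightarrow> complex \<Rightarrow> complex" where
  "colored_jones K N h = (case K of (d, u) \<Rightarrow>
     qpow h (- of_int (writhe u) * (of_nat N ^ 2 - 1) / 4) *
     (\<Sum>x\<in>basis_states N d. braid_mat h N d u x x *
        (\<Prod>i\<leftarrow>x. qpow h ((2 * of_nat i - of_nat N + 1) / 2))))"


section \<open>Summands\<close>

text \<open>
  The data of a summand. Vectors are functions on indices \<open>0..nu\<close> (values beyond \<open>nu\<close> are ignored),
  index \<open>0\<close> belonging to \<open>m\<close>; \<open>nums\<close> and \<open>dens\<close> list the pairs \<open>(p\<^sub>s, r\<^sub>s)\<close> and \<open>(p'\<^sub>t, r'\<^sub>t)\<close>.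
\<close>

record summand_data =
  nu :: nat
  sgn_vec :: "nat \<Rightarrow> nat"
  quad :: "nat \<Rightarrow> nat \<Rightarrow> int"
  lin_vec :: "nat \<Rightarrow> rat"
  cst :: int
  nums :: "((nat \<Rightarrow> int) \<times> int) list"
  dens :: "((nat \<Rightarrow> int) \<times> int) list"

definition summand_form :: "summand_data \<Rightarrow> bool" where
  "summand_form F \<longleftrightarrow>
     (\<forall>i\<le>nu F. sgn_vec F i \<in> {0, 1}) \<and>
     (\<forall>i\<le>nu F. \<forall>j\<le>nu F. quad F i j = quad F j i)"

definition idot :: "nat \<Rightarrow> (nat \<Rightarrow> int) \<Rightarrow> (nat \<Rightarrow> complex) \<Rightarrow> complex" where
  "idot v p k = (\<Sum>i\<le>v. of_int (p i) * k i)"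

text \<open>
  The function \<open>F\<close> of \<open>k = (m, k\<^sub>1, \<dots>, k\<^sub>\<nu>)\<close>, with \<open>P x\<close> in place of the symbol \<open>(q)\<^sub>x\<close>
  and \<open>(-1) ^ x\<close> read as \<open>exp (\<pi> \<i> x)\<close> (\<open>m\<close> may be half-integral).
\<close>

definition summand_fun ::
  "(complex \<Rightarrow> complex) \<Rightarrow> complex \<Rightarrow> summand_data \<Rightarrow> (nat \<Rightarrow> complex) \<Rightarrow> complex" where
  "summand_fun P h F k =
     exp (of_real pi * \<i> * (\<Sum>i\<le>nu F. of_nat (sgn_vec F i) * k i)) *
     qpow h (1/2 * (\<Sum>i\<le>nu F. \<Sum>j\<le>nu F. of_int (quad F i j) * k i * k j)
             + (\<Sum>i\<le>nu F. of_rat (lin_vec F i) * k i) + of_int (cst F)) *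
     ((\<Prod>(p, r)\<leftarrow>nums F. P (idot (nu F) p k + of_int r)) /
      (\<Prod>(p, r)\<leftarrow>dens F. P (idot (nu F) p k + of_int r)))"

text \<open>\<open>(q)\<^sub>n = (1 - q) \<dots> (1 - q ^ n)\<close>, to be used at arguments \<open>x \<in> \<nat>\<close> only.\<close>

definition q_fact :: "complex \<Rightarrow> complex \<Rightarrow> complex" where
  "q_fact h x = (\<Prod>i=1..nat \<lfloor>Re x\<rfloor>. 1 - qpow h (of_nat i))"

text \<open>
  \<open>J\<^sub>n(K; q) = \<Sum> F(m, k\<^sub>1, \<dots>, k\<^sub>\<nu>)\<close> with \<open>n = 2 m + 1\<close>, summed over a finite range \<open>S n\<close>
  of (half-)integers \<open>k\<^sub>1, \<dots>, k\<^sub>\<nu>\<close> on which all symbols \<open>(q)\<^sub>x\<close> are defined.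
\<close>

definition is_summand_of :: "summand_data \<Rightarrow> (nat \<Rightarrow> (nat \<Rightarrow> complex) set) \<Rightarrow> braid \<Rightarrow> bool" where
  "is_summand_of F S K \<longleftrightarrow> (\<forall>n\<ge>1. let m = (of_nat n - 1) / 2 in
     finite (S n) \<and>
     S n \<subseteq> ({1..nu F} \<rightarrow>\<^sub>E {x. 2 * x \<in> \<int>}) \<and>
     (\<forall>k\<in>S n. \<forall>(p, r)\<in>set (nums F) \<union> set (dens F).
        idot (nu F) p (k(0 := m)) + of_int r \<in> \<nat>) \<and>
     (\<forall>h. generic_q h \<longrightarrow>
        colored_jones K n h = (\<Sum>k\<in>S n. summand_fun (q_fact h) h F (k(0 := m)))))"


section \<open>The ratios of shifts and their evaluation at \<open>q = 1\<close>\<close>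

definition shift_op :: "nat \<Rightarrow> ((nat \<Rightarrow> complex) \<Rightarrow> complex) \<Rightarrow> (nat \<Rightarrow> complex) \<Rightarrow> complex" where
  "shift_op j f k = f (k(j := k j + 1))"

text \<open>
  Laurent polynomials in \<open>Q\<^sub>0, \<dots>, Q\<^sub>v\<close> and fractional powers of \<open>q\<close>, as functions of
  \<open>h\<close> and \<open>Q\<close>, which are independent of each other.
\<close>

inductive laurent :: "nat \<Rightarrow> (complex \<Rightarrow> (nat \<Rightarrow> complex) \<Rightarrow> complex) \<Rightarrow> bool" for v where
  "laurent v (\<lambda>h Q. c)"
| "laurent v (\<lambda>h Q. qpow h (of_rat x))"
| "i \<le> v \<Longrightarrow> laurent v (\<lambda>h Q. Q i powi n)"
| "laurent v f \<Longrightarrow> laurent v g \<Longrightarrow> laurent v (\<lambda>h Q. f h Q + g h Q)"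
| "laurent v f \<Longrightarrow> laurent v g \<Longrightarrow> laurent v (\<lambda>h Q. f h Q * g h Q)"

text \<open>
  Formal computation with \<open>(q)\<^sub>x\<close>: nothing is used except that it is nonzero and that
  \<open>(q)\<^bsub>x+1\<^esub> = (1 - q ^ (x+1)) (q)\<^sub>x\<close>. The proviso \<open>q ^ (x+1) \<noteq> 1\<close> concerns only the
  step into \<open>(q)\<^sub>0\<close>.
\<close>

definition q_fact_symbol :: "complex \<Rightarrow> (complex \<Rightarrow> complex) \<Rightarrow> bool" where
  "q_fact_symbol h P \<longleftrightarrow> (\<forall>x. P x \<noteq> 0) \<and>
     (\<forall>x. qpow h (x + 1) \<noteq> 1 \<longrightarrow> P (x + 1) = (1 - qpow h (x + 1)) * P x)"

definition nonzero_vec :: "nat \<Rightarrow> (nat \<Rightarrow> int) \<Rightarrow> bool" where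
  "nonzero_vec v p \<longleftrightarrow> (\<exists>i\<le>v. p i \<noteq> 0)"

text \<open>
  The rational function \<open>N / D\<close> is \<open>E\<^sub>j F / F\<close> with \<open>q ^ k\<^sub>i\<close> replaced by \<open>Q\<^sub>i\<close>. The \<open>k\<^sub>i\<close> range over
  generic complex numbers, so that the \<open>q ^ k\<^sub>i\<close> are independent of each other and of \<open>q\<close>.
\<close>

definition ratio_is ::
  "summand_data \<Rightarrow> nat \<Rightarrow> (complex \<Rightarrow> (nat \<Rightarrow> complex) \<Rightarrow> complex)
     \<Rightarrow> (complex \<Rightarrow> (nat \<Rightarrow> complex) \<Rightarrow> complex) \<Rightarrow> bool" where
  "ratio_is F j N D \<longleftrightarrow> laurent (nu F) N \<and> laurent (nu F) D \<and>
     (\<forall>h k P. generic_q h \<longrightarrow> q_fact_symbol h P \<longrightarrow>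
        (\<forall>(p, r)\<in>set (nums F) \<union> set (dens F). nonzero_vec (nu F) p \<longrightarrow>
           (\<forall>n::int. qpow h (idot (nu F) p k + of_int n) \<noteq> 1)) \<longrightarrow>
        D h (\<lambda>i. qpow h (k i)) \<noteq> 0 \<longrightarrow>
        shift_op j (summand_fun P h F) k / summand_fun P h F k =
          N h (\<lambda>i. qpow h (k i)) / D h (\<lambda>i. qpow h (k i)))"

text \<open>\<open>\<epsilon>\<close> of the ratio, as a function of \<open>Q\<close>; the ratio is written with a denominator that does not
  vanish at \<open>q = 1\<close> and the given \<open>Q\<close>.\<close>

definition eps_ratio :: "summand_data \<Rightarrow> nat \<Rightarrow> (nat \<Rightarrow> complex) \<Rightarrow> complex" where
  "eps_ratio F j Q = (THE z. \<exists>N D. ratio_is F j N D \<and> D 0 Q \<noteq> 0 \<and> z = N 0 Q / D 0 Q)"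


section \<open>The potential function\<close>

definition vec_power :: "nat \<Rightarrow> (nat \<Rightarrow> complex) \<Rightarrow> (nat \<Rightarrow> int) \<Rightarrow> complex" where
  "vec_power v w p = (\<Prod>i\<le>v. w i powi p i)"

text \<open>\<open>\<Phi>\<^sub>F\<close> is multivalued; we use all of its branches, not only those of a fixed system of cuts.\<close>

definition log_branch :: "complex \<Rightarrow> (complex \<Rightarrow> complex) \<Rightarrow> bool" where
  "log_branch z0 lg \<longleftrightarrow> (\<exists>r>0. lg holomorphic_on ball z0 r \<and> (\<forall>z\<in>ball z0 r. exp (lg z) = z))"

text \<open>
  A branch of \<open>Li\<^sub>2(z) = - \<integral>\<^sub>0\<^sup>z log (1 - x) / x dx\<close> near \<open>z0\<close>: integrate along a path \<open>g\<close> from \<open>0\<close> to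
  \<open>z0\<close>, continuing \<open>log (1 - x)\<close> along \<open>g\<close> (the function \<open>L\<close>) from its value \<open>0\<close> at \<open>x = 0\<close>, and then
  along the segment from \<open>z0\<close> to \<open>z\<close>. For \<open>z0 = 1\<close> only the value at the branch point, such as
  \<open>Li\<^sub>2(1) = \<pi>\<^sup>2/6\<close>, is described; it occurs in the constant terms with \<open>p\<^sub>s = 0\<close>.
\<close>

definition dilog_branch :: "complex \<Rightarrow> (complex \<Rightarrow> complex) \<Rightarrow> bool" where
  "dilog_branch z0 Li \<longleftrightarrow> (\<exists>g L.
     valid_path g \<and> pathstart g = 0 \<and> pathfinish g = z0 \<and> (\<forall>t\<in>{0<..<1}. g t \<notin> {0, 1}) \<and>
     continuous_on {0..<1} L \<and> L 0 = 0 \<and> (\<forall>t\<in>{0..<1}. exp (L t) = 1 - g t) \<and>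
     ((\<lambda>t. L t / g t * vector_derivative g (at t within {0..1})) has_integral (- Li z0)) {0..1} \<and>
     (z0 \<noteq> 1 \<longrightarrow> (\<exists>r>0. \<exists>l.
        0 \<notin> ball z0 r \<and> l holomorphic_on ball z0 r \<and> (\<forall>z\<in>ball z0 r. exp (l z) = 1 - z) \<and>
        (L \<longlongrightarrow> l z0) (at_left 1) \<and>
        (\<forall>z\<in>ball z0 r. Li z = Li z0 - contour_integral (linepath z0 z) (\<lambda>x. l x / x)))))"

definition potential ::
  "summand_data \<Rightarrow> (nat \<Rightarrow> complex \<Rightarrow> complex) \<Rightarrow> (nat \<Rightarrow> complex \<Rightarrow> complex)
     \<Rightarrow> (nat \<Rightarrow> complex \<Rightarrow> complex) \<Rightarrow> (nat \<Rightarrow> complex) \<Rightarrow> complex" where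
  "potential F lg Li Li' w =
     of_real pi * \<i> * (\<Sum>i\<le>nu F. of_nat (sgn_vec F i) * lg i (w i))
     + 1/2 * (\<Sum>i\<le>nu F. \<Sum>j\<le>nu F. of_int (quad F i j) * lg i (w i) * lg j (w j))
     + (\<Sum>s<length (nums F). - Li s (vec_power (nu F) w (fst (nums F ! s))) + of_real (pi^2 / 6))
     - (\<Sum>t<length (dens F). - Li' t (vec_power (nu F) w (fst (dens F ! t))) + of_real (pi^2 / 6))"

definition potential_branch ::
  "summand_data \<Rightarrow> (nat \<Rightarrow> complex) \<Rightarrow> ((nat \<Rightarrow> complex) \<Rightarrow> complex) \<Rightarrow> bool" where
  "potential_branch F w \<Phi> \<longleftrightarrow> (\<exists>lg Li Li'.
     (\<forall>i\<le>nu F. log_branch (w i) (lg i)) \<and>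
     (\<forall>s<length (nums F). dilog_branch (vec_power (nu F) w (fst (nums F ! s))) (Li s)) \<and>
     (\<forall>t<length (dens F). dilog_branch (vec_power (nu F) w (fst (dens F ! t))) (Li' t)) \<and>
     \<Phi> = potential F lg Li Li')"

text \<open>Points \<open>w = (\<alpha>, w\<^sub>1, \<dots>, w\<^sub>\<nu>)\<close> off the branch loci of the logarithms and dilogarithms.\<close>

definition regular_point :: "summand_data \<Rightarrow> (nat \<Rightarrow> complex) \<Rightarrow> bool" where
  "regular_point F w \<longleftrightarrow> (\<forall>i\<le>nu F. w i \<noteq> 0) \<and>
     (\<forall>(p, r)\<in>set (nums F) \<union> set (dens F). nonzero_vec (nu F) p \<longrightarrow> vec_power (nu F) w p \<noteq> 1)"

definition partial_deriv ::
  "nat \<Rightarrow> ((nat \<Rightarrow> complex) \<Rightarrow> complex) \<Rightarrow> (nat \<Rightarrow> complex) \<Rightarrow> complex" where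
  "partial_deriv j \<Phi> w = deriv (\<lambda>z. \<Phi> (w(j := z))) (w j)"

end

theory Submission
  imports Defs
begin

text \<open>
  Both sides equal \<open>(-1)\<^bsup>e\<^sub>j\<^esup> \<Prod>\<^sub>i w\<^sub>i\<^bsup>a\<^sub>i\<^sub>j\<^esup> \<Prod>\<^sub>s (1 - w\<^bsup>p\<^sub>s\<^esup>)\<^bsup>p\<^sub>s\<^sub>j\<^esup> / \<Prod>\<^sub>t (1 - w\<^bsup>p'\<^sub>t\<^esup>)\<^bsup>p'\<^sub>t\<^sub>j\<^esup>\<close>.
  On the side of the potential this is \<open>z Li\<^sub>2'(z) = - log (1 - z)\<close>, and the choice of the
  branches disappears in the exponential. On the side of the ratio, \<open>(q)\<^bsub>x+p\<^esub> / (q)\<^sub>x\<close> is a product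
  of \<open>p\<close> factors \<open>1 - q\<^bsup>x+i\<^esup>\<close>, which coincide at \<open>q = 1\<close>. The value at \<open>q = 1\<close> does not
  depend on the fraction representing the ratio: with \<open>Q = w\<close> kept fixed, all but countably many \<open>h\<close>
  are generic, so two fractions agree on a set accumulating at \<open>h = 0\<close>.
\<close>

text \<open>The common value of both sides. A zero vector \<open>p\<close> has
  \<open>vec_power\<close> equal to 1, but then \<open>p j = 0\<close> for \<open>j\<close> up to
  \<open>nu F\<close>, and \<open>0 powi 0 = 1\<close> makes its factor trivial.\<close>

definition limit_ratio :: "summand_data \<Rightarrow> nat \<Rightarrow> (nat \<Rightarrow> complex) \<Rightarrow> complex" where
  "limit_ratio F j w = exp (of_real pi * \<i> * of_nat (sgn_vec F j)) *
     (\<Prod>i\<le>nu F. w i powi quad F i j) *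
     ((\<Prod>(p, r)\<leftarrow>nums F. (1 - vec_power (nu F) w p) powi p j) /
      (\<Prod>(p, r)\<leftarrow>dens F. (1 - vec_power (nu F) w p) powi p j))"


section \<open>The potential function\<close>

text \<open>Differentiate \<open>exp (lg z) = z\<close> on the disc. The resulting equation
  \<open>z0 * deriv lg z0 = 1\<close> also excludes \<open>z0 = 0\<close>.\<close>

lemma log_branch_has_field_derivative:
  assumes "log_branch z0 lg"
  shows "(lg has_field_derivative 1 / z0) (at z0)" and "exp (lg z0) = z0"
proof -
  obtain r where r: "r > 0" "lg holomorphic_on ball z0 r" "\<And>z. z \<in> ball z0 r \<Longrightarrow> exp (lg z) = z"
    using assms unfolding log_branch_def by blast
  show e: "exp (lg z0) = z0" using r by simp
  have d: "(lg has_field_derivative deriv lg z0) (at z0)"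
    using r by (intro holomorphic_derivI[of _ "ball z0 r"]) auto
  have "((\<lambda>z. exp (lg z)) has_field_derivative exp (lg z0) * deriv lg z0) (at z0)"
    using d by (auto intro!: derivative_eq_intros)
  moreover have "((\<lambda>z. exp (lg z)) has_field_derivative 1) (at z0)"
    using r by (intro has_field_derivative_transform_within_open[OF DERIV_ident, of "ball z0 r"]) auto
  ultimately have "z0 * deriv lg z0 = 1"
    using e DERIV_unique by metis
  then have "deriv lg z0 = 1 / z0" by (metis mult_zero_left nonzero_mult_div_cancel_left zero_neq_one)
  then show "(lg has_field_derivative 1 / z0) (at z0)" using d by simp
qed

text \<open>On a convex disc around \<open>z0\<close> the function \<open>l x / x\<close> has a
  primitive, and the segment integral makes \<open>Li\<close> a constant minus this primitive. Which
  logarithm \<open>l\<close> of \<open>1 - z0\<close> occurs depends on the path, hence the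
  existential form.\<close>

lemma dilog_branch_has_field_derivative:
  assumes "dilog_branch z0 Li" and "z0 \<noteq> 1"
  obtains l where "exp l = 1 - z0" and "(Li has_field_derivative - l / z0) (at z0)"
proof -
  obtain r l where r: "r > 0" "0 \<notin> ball z0 r" "l holomorphic_on ball z0 r"
      "\<And>z. z \<in> ball z0 r \<Longrightarrow> exp (l z) = 1 - z"
      "\<And>z. z \<in> ball z0 r \<Longrightarrow> Li z = Li z0 - contour_integral (linepath z0 z) (\<lambda>x. l x / x)"
    using assms unfolding dilog_branch_def by blast
  have z0: "z0 \<in> ball z0 r" using r by simp
  have "(\<lambda>x. l x / x) holomorphic_on ball z0 r"
    using r by (intro holomorphic_intros) auto
  then obtain g where g:
      "\<And>x. x \<in> ball z0 r \<Longrightarrow> (g has_field_derivative l x / x) (at x within ball z0 r)"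
    using holomorphic_convex_primitive'[of "ball z0 r" "\<lambda>x. l x / x"] by auto
  have Li: "Li z = Li z0 - (g z - g z0)" if "z \<in> ball z0 r" for z
  proof -
    have "path_image (linepath z0 z) \<subseteq> ball z0 r"
      using that z0 convex_contains_segment[of "ball z0 r"] by (simp del: mem_ball)
    then have "((\<lambda>x. l x / x) has_contour_integral (g z - g z0)) (linepath z0 z)"
      using contour_integral_primitive[OF g, of "linepath z0 z"] by simp
    then show ?thesis by (simp only: r(5)[OF that] contour_integral_unique)
  qed
  have "(g has_field_derivative l z0 / z0) (at z0)"
    using g[OF z0] at_within_open[of z0 "ball z0 r"] z0 by simp
  then have "((\<lambda>z. Li z0 - (g z - g z0)) has_field_derivative - l z0 / z0) (at z0)"
    by (auto intro!: derivative_eq_intros)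
  then have "(Li has_field_derivative - l z0 / z0) (at z0)"
    by (rule has_field_derivative_transform_within_open[OF _ open_ball z0]) (rule Li[symmetric])
  with r(4)[OF z0] show ?thesis using that by blast
qed

lemma vec_power_nonzero: "(\<And>i. i \<le> v \<Longrightarrow> w i \<noteq> 0) \<Longrightarrow> vec_power v w p \<noteq> 0"
  by (simp add: vec_power_def)

lemma vec_power_zero_vec: "\<not> nonzero_vec v p \<Longrightarrow> vec_power v w p = 1"
  by (simp add: vec_power_def nonzero_vec_def)

lemma vec_power_has_field_derivative:
  assumes "j \<le> v" and "w j \<noteq> 0"
  shows "((\<lambda>z. vec_power v (w(j := z)) p) has_field_derivative
           of_int (p j) * vec_power v w p / w j) (at (w j))"
proof -
  \<comment> \<open>The part of the monomial that stays constant when only the coordinate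
    \<open>j\<close> moves.\<close>
  define C where "C = (\<Prod>i\<in>{..v} - {j}. w i powi p i)"
  have e: "vec_power v (w(j := z)) p = z powi p j * C" for z
    using assms(1) by (simp add: vec_power_def C_def prod.remove[of "{..v}" j])
  have "vec_power v w p = w j powi p j * C"
    using e[of "w j"] by simp
  moreover have "w j powi (p j - 1) = w j powi p j / w j"
    using assms(2) by (simp add: power_int_diff)
  ultimately show ?thesis
    unfolding e using assms(2) by (auto intro!: derivative_eq_intros)
qed

text \<open>A derivative at the branch point \<open>1\<close> is not available, but there the argument is constant.\<close>

lemma dilog_vec_power_has_field_derivative:
  assumes "j \<le> v" and w: "\<And>i. i \<le> v \<Longrightarrow> w i \<noteq> 0"
    and "nonzero_vec v p \<Longrightarrow> vec_power v w p \<noteq> 1"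
    and "dilog_branch (vec_power v w p) Li"
  obtains L where "exp L = (1 - vec_power v w p) powi p j"
    and "((\<lambda>z. - Li (vec_power v (w(j := z)) p) + c) has_field_derivative L / w j) (at (w j))"
proof (cases "nonzero_vec v p")
  case True
  obtain l where l: "exp l = 1 - vec_power v w p"
      "(Li has_field_derivative - l / vec_power v w p) (at (vec_power v w p))"
    using dilog_branch_has_field_derivative assms(3)[OF True] assms(4) by blast
  have "((\<lambda>z. Li (vec_power v (w(j := z)) p)) has_field_derivative
     (- l / vec_power v w p) * (of_int (p j) * vec_power v w p / w j)) (at (w j))"
    using l(2) vec_power_has_field_derivative[of j v w p] assms(1) w
    by (intro DERIV_chain2[where f = Li]) auto
  \<comment> \<open>The monomial produced by the inner derivative cancels the denominator of the
    derivative of \<open>Li\<close>.\<close>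
  then have "((\<lambda>z. Li (vec_power v (w(j := z)) p)) has_field_derivative
     - (of_int (p j) * l) / w j) (at (w j))"
    using vec_power_nonzero[of v w p, OF w] by (simp add: field_simps)
  then have "((\<lambda>z. - Li (vec_power v (w(j := z)) p) + c) has_field_derivative
     of_int (p j) * l / w j) (at (w j))"
    by (auto intro!: derivative_eq_intros)
  moreover have "exp (of_int (p j) * l) = (1 - vec_power v w p) powi p j"
    using exp_power_int[of l "p j"] l(1) by (simp add: mult.commute)
  ultimately show ?thesis using that by blast
next
  case False
  \<comment> \<open>The argument is constantly 1, so the derivative is 0; the witness
    \<open>L = 0\<close> fits because \<open>exp 0 = 0 powi 0\<close>.\<close>
  with assms(1) have "p j = 0" by (auto simp: nonzero_vec_def)
  with False show ?thesis using that[of 0] by (simp add: vec_power_zero_vec)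
qed

text \<open>The variable \<open>w j\<close> enters through row \<open>j\<close> and column
  \<open>j\<close>; by symmetry they contribute equally, which cancels the factor 1/2.\<close>

lemma quadratic_has_field_derivative:
  fixes a :: "nat \<Rightarrow> nat \<Rightarrow> complex"
  assumes "j \<le> v" and sym: "\<And>i. i \<le> v \<Longrightarrow> a j i = a i j"
    and lg: "\<And>i. i \<le> v \<Longrightarrow> (lg i has_field_derivative g i) (at (w i))"
  shows "((\<lambda>z. 1/2 * (\<Sum>i\<le>v. \<Sum>k\<le>v. a i k * lg i ((w(j := z)) i) * lg k ((w(j := z)) k)))
     has_field_derivative (\<Sum>i\<le>v. a i j * lg i (w i)) * g j) (at (w j))"
proof -
  have d: "((\<lambda>z. lg i ((w(j := z)) i)) has_field_derivative (if i = j then g j else 0)) (at (w j))"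
    if "i \<le> v" for i
    using lg[OF that] by auto
  have "((\<lambda>z. 1/2 * (\<Sum>i\<le>v. \<Sum>k\<le>v. a i k * lg i ((w(j := z)) i) * lg k ((w(j := z)) k)))
     has_field_derivative 1/2 * (\<Sum>i\<le>v. \<Sum>k\<le>v. a i k * lg i (w i) * (if k = j then g j else 0)
        + a i k * (if i = j then g j else 0) * lg k (w k))) (at (w j))"
    by (rule derivative_eq_intros DERIV_sum d refl | simp add: algebra_simps)+
  moreover have "(\<Sum>i\<le>v. \<Sum>k\<le>v. a i k * lg i (w i) * (if k = j then g j else 0)
        + a i k * (if i = j then g j else 0) * lg k (w k))
      = (\<Sum>i\<le>v. a i j * lg i (w i) * g j) + (\<Sum>k\<le>v. a j k * g j * lg k (w k))"
  proof -
    have "(\<Sum>k\<le>v. a i k * (if i = j then g j else 0) * lg k (w k)) =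
        (if i = j then \<Sum>k\<le>v. a i k * g j * lg k (w k) else 0)" for i
      by simp
    moreover have "(\<Sum>k\<le>v. a i k * lg i (w i) * (if k = j then g j else 0)) = a i j * lg i (w i) * g j" for i
      using assms(1) by (simp add: if_distrib[where f = "\<lambda>x. _ * x"] cong: if_cong)
    ultimately show ?thesis using assms(1) by (simp add: sum.distrib)
  qed
  moreover have "(\<Sum>k\<le>v. a j k * g j * lg k (w k)) = (\<Sum>i\<le>v. a i j * lg i (w i) * g j)"
    using sym by (intro sum.cong) auto
  ultimately show ?thesis by (simp add: sum_distrib_right)
qed

lemma exp_partial_deriv_potential:
  assumes "summand_form F" and "regular_point F w" and "potential_branch F w \<Phi>" and j: "j \<le> nu F"
  shows "exp (w j * partial_deriv j \<Phi> w) = limit_ratio F j w"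
proof -
  obtain lg Li Li' where lg: "\<And>i. i \<le> nu F \<Longrightarrow> log_branch (w i) (lg i)"
    and Li: "\<And>s. s < length (nums F) \<Longrightarrow> dilog_branch (vec_power (nu F) w (fst (nums F ! s))) (Li s)"
    and Li': "\<And>t. t < length (dens F) \<Longrightarrow> dilog_branch (vec_power (nu F) w (fst (dens F ! t))) (Li' t)"
    and \<Phi>: "\<Phi> = potential F lg Li Li'"
    using assms(3) unfolding potential_branch_def by blast
  have w: "\<And>i. i \<le> nu F \<Longrightarrow> w i \<noteq> 0"
    and reg: "\<And>x. x \<in> set (nums F) \<union> set (dens F) \<Longrightarrow> nonzero_vec (nu F) (fst x)
       \<Longrightarrow> vec_power (nu F) w (fst x) \<noteq> 1"
    using assms(2) unfolding regular_point_def by auto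
  let ?V = "\<lambda>x. vec_power (nu F) w (fst x)"
  let ?c = "of_real (pi^2 / 6) :: complex"
  have "\<exists>L. exp L = (1 - ?V (nums F ! s)) powi fst (nums F ! s) j \<and>
      ((\<lambda>z. - Li s (vec_power (nu F) (w(j := z)) (fst (nums F ! s))) + ?c)
        has_field_derivative L / w j) (at (w j))" if "s < length (nums F)" for s
    using dilog_vec_power_has_field_derivative[OF j w reg Li[OF that]] that
    by (metis UnI1 nth_mem)
  then obtain L where L: "\<And>s. s < length (nums F) \<Longrightarrow>
       exp (L s) = (1 - ?V (nums F ! s)) powi fst (nums F ! s) j"
    "\<And>s. s < length (nums F) \<Longrightarrow>
       ((\<lambda>z. - Li s (vec_power (nu F) (w(j := z)) (fst (nums F ! s))) + ?c)
         has_field_derivative L s / w j) (at (w j))"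
    by metis
  have "\<exists>L. exp L = (1 - ?V (dens F ! t)) powi fst (dens F ! t) j \<and>
      ((\<lambda>z. - Li' t (vec_power (nu F) (w(j := z)) (fst (dens F ! t))) + ?c)
        has_field_derivative L / w j) (at (w j))" if "t < length (dens F)" for t
    using dilog_vec_power_has_field_derivative[OF j w reg Li'[OF that]] that
    by (metis UnI2 nth_mem)
  then obtain L' where L': "\<And>t. t < length (dens F) \<Longrightarrow>
       exp (L' t) = (1 - ?V (dens F ! t)) powi fst (dens F ! t) j"
    "\<And>t. t < length (dens F) \<Longrightarrow>
       ((\<lambda>z. - Li' t (vec_power (nu F) (w(j := z)) (fst (dens F ! t))) + ?c)
         has_field_derivative L' t / w j) (at (w j))"
    by metis
  \<comment> \<open>Every term of the derivative carries \<open>1 / w j\<close>; \<open>?E\<close>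
    is what remains after clearing it. Its terms exponentiate to the factors of
    \<open>limit_ratio\<close>, since the logarithms enter with integer weights.\<close>
  let ?E = "of_real pi * \<i> * of_nat (sgn_vec F j) + (\<Sum>i\<le>nu F. of_int (quad F i j) * lg i (w i))
     + (\<Sum>s<length (nums F). L s) - (\<Sum>t<length (dens F). L' t)"
  have d: "((\<lambda>z. lg i ((w(j := z)) i)) has_field_derivative (if i = j then 1 / w j else 0)) (at (w j))"
    if "i \<le> nu F" for i
    using log_branch_has_field_derivative(1)[OF lg[OF that]] by auto
  have "((\<lambda>z. \<Sum>i\<le>nu F. of_nat (sgn_vec F i) * lg i ((w(j := z)) i)) has_field_derivative
      (\<Sum>i\<le>nu F. of_nat (sgn_vec F i) * (if i = j then 1 / w j else 0))) (at (w j))"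
    by (intro DERIV_sum DERIV_cmult d) simp
  also have "(\<Sum>i\<le>nu F. of_nat (sgn_vec F i) * (if i = j then 1 / w j else 0))
      = of_nat (sgn_vec F j) / w j"
    using j by (simp add: if_distrib[where f = "\<lambda>x. _ * x"] cong: if_cong)
  finally have d1: "((\<lambda>z. of_real pi * \<i> * (\<Sum>i\<le>nu F. of_nat (sgn_vec F i) * lg i ((w(j := z)) i)))
      has_field_derivative of_real pi * \<i> * (of_nat (sgn_vec F j) / w j)) (at (w j))"
    by (rule DERIV_cmult)
  have d2: "((\<lambda>z. 1/2 * (\<Sum>i\<le>nu F. \<Sum>k\<le>nu F. of_int (quad F i k) * lg i ((w(j := z)) i) * lg k ((w(j := z)) k)))
      has_field_derivative (\<Sum>i\<le>nu F. of_int (quad F i j) * lg i (w i)) * (1 / w j)) (at (w j))"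
    using assms(1) j unfolding summand_form_def
    by (intro quadratic_has_field_derivative log_branch_has_field_derivative lg) auto
  have "((\<lambda>z. \<Phi> (w(j := z))) has_field_derivative of_real pi * \<i> * (of_nat (sgn_vec F j) / w j)
      + (\<Sum>i\<le>nu F. of_int (quad F i j) * lg i (w i)) * (1 / w j)
      + (\<Sum>s<length (nums F). L s / w j) - (\<Sum>t<length (dens F). L' t / w j)) (at (w j))"
    unfolding \<Phi> potential_def
    by (intro DERIV_add DERIV_diff d1 d2 DERIV_sum L L') auto
  also have "of_real pi * \<i> * (of_nat (sgn_vec F j) / w j)
      + (\<Sum>i\<le>nu F. of_int (quad F i j) * lg i (w i)) * (1 / w j)
      + (\<Sum>s<length (nums F). L s / w j) - (\<Sum>t<length (dens F). L' t / w j) = ?E / w j"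
    by (simp add: add_divide_distrib diff_divide_distrib sum_divide_distrib)
  finally have "partial_deriv j \<Phi> w = ?E / w j"
    unfolding partial_deriv_def by (rule DERIV_imp_deriv)
  then have "exp (w j * partial_deriv j \<Phi> w) = exp ?E"
    using w[OF j] by simp
  also have "\<dots> = exp (of_real pi * \<i> * of_nat (sgn_vec F j)) *
      (\<Prod>i\<le>nu F. exp (of_int (quad F i j) * lg i (w i))) *
      ((\<Prod>s<length (nums F). exp (L s)) / (\<Prod>t<length (dens F). exp (L' t)))"
    by (simp add: exp_add exp_diff exp_sum)
  also have "(\<Prod>i\<le>nu F. exp (of_int (quad F i j) * lg i (w i))) = (\<Prod>i\<le>nu F. w i powi quad F i j)"
    using log_branch_has_field_derivative(2)[OF lg]
    by (intro prod.cong refl) (metis atMost_iff exp_power_int mult.commute)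
  also have "(\<Prod>s<length (nums F). exp (L s)) =
      (\<Prod>(p, r)\<leftarrow>nums F. (1 - vec_power (nu F) w p) powi p j)"
    using L(1) by (simp add: prod.list_conv_set_nth lessThan_atLeast0 case_prod_unfold)
  also have "(\<Prod>t<length (dens F). exp (L' t)) =
      (\<Prod>(p, r)\<leftarrow>dens F. (1 - vec_power (nu F) w p) powi p j)"
    using L'(1) by (simp add: prod.list_conv_set_nth lessThan_atLeast0 case_prod_unfold)
  finally show ?thesis by (simp add: limit_ratio_def)
qed


section \<open>Laurent polynomials\<close>

lemma laurent_prod_list:
  assumes "\<And>x. x \<in> set xs \<Longrightarrow> laurent v (f x)"
  shows "laurent v (\<lambda>h Q. \<Prod>x\<leftarrow>xs. f x h Q)"
  using assms by (induction xs) (auto intro: laurent.intros)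

lemma laurent_prod:
  assumes "\<And>x. x \<in> A \<Longrightarrow> laurent v (f x)"
  shows "laurent v (\<lambda>h Q. \<Prod>x\<in>A. f x h Q)"
  using assms by (induction A rule: infinite_finite_induct) (auto intro: laurent.intros)

lemma laurent_qpow_of_int: "laurent v (\<lambda>h Q. qpow h (of_int n))"
  using laurent.intros(2)[of v "of_int n"] by simp

lemma laurent_vec_power: "laurent v (\<lambda>h Q. vec_power v Q p)"
  unfolding vec_power_def by (intro laurent_prod laurent.intros) auto

lemma laurent_one_minus:
  assumes "laurent v f"
  shows "laurent v (\<lambda>h Q. 1 - f h Q)"
  using laurent.intros(4)[OF laurent.intros(1)[of v 1] laurent.intros(5)[OF laurent.intros(1)[of v "-1"] assms]]
  by simp

text \<open>With \<open>Q\<close> fixed, this turns evaluation at q = 1 into a limit for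
  \<open>h\<close> tending to 0.\<close>

lemma laurent_continuous:
  assumes "laurent v f"
  shows "continuous_on UNIV (\<lambda>h. f h Q)"
  using assms by (induction) (auto simp: qpow_def intro!: continuous_intros)

lemma laurent_cong:
  assumes "laurent v f" and "\<And>i. i \<le> v \<Longrightarrow> Q i = Q' i"
  shows "f h Q = f h Q'"
  using assms by (induction) auto

lemma vec_power_qpow: "vec_power v (\<lambda>i. qpow h (k i)) p = qpow h (idot v p k)"
  by (simp add: vec_power_def qpow_def idot_def exp_sum sum_distrib_left exp_power_int mult_ac)

lemma qpow_add: "qpow h (x + y) = qpow h x * qpow h y"
  by (simp add: qpow_def ring_distribs exp_add)


section \<open>The ratios as fractions of Laurent polynomials\<close>

text \<open>
  \<open>shift_num v j (p, r) / shift_den v j (p, r)\<close> is the ratio of \<open>(q)\<^bsub>x + p\<^sub>j\<^esub>\<close> and \<open>(q)\<^sub>x\<close> at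
  \<open>x = (p, k) + r\<close>; one of the two products is empty, depending on the sign of \<open>p\<^sub>j\<close>.
\<close>

definition shift_num :: "nat \<Rightarrow> nat \<Rightarrow> (nat \<Rightarrow> int) \<times> int \<Rightarrow> complex \<Rightarrow> (nat \<Rightarrow> complex) \<Rightarrow> complex" where
  "shift_num v j x h Q =
     (\<Prod>i\<in>{1..fst x j}. 1 - qpow h (of_int (snd x + i)) * vec_power v Q (fst x))"

definition shift_den :: "nat \<Rightarrow> nat \<Rightarrow> (nat \<Rightarrow> int) \<times> int \<Rightarrow> complex \<Rightarrow> (nat \<Rightarrow> complex) \<Rightarrow> complex" where
  "shift_den v j x h Q =
     (\<Prod>i\<in>{fst x j + 1..0}. 1 - qpow h (of_int (snd x + i)) * vec_power v Q (fst x))"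

text \<open>The power of q is the part of the change of the exponent that does not involve
  \<open>k\<close>. The symbols in \<open>dens\<close> enter inverted, so \<open>shift_num\<close>
  and \<open>shift_den\<close> trade places for them.\<close>

definition ratio_num :: "summand_data \<Rightarrow> nat \<Rightarrow> complex \<Rightarrow> (nat \<Rightarrow> complex) \<Rightarrow> complex" where
  "ratio_num F j h Q = exp (of_real pi * \<i> * of_nat (sgn_vec F j)) *
     (qpow h (of_rat (of_int (quad F j j) / 2 + lin_vec F j)) * (\<Prod>i\<le>nu F. Q i powi quad F i j)) *
     ((\<Prod>x\<leftarrow>nums F. shift_num (nu F) j x h Q) * (\<Prod>x\<leftarrow>dens F. shift_den (nu F) j x h Q))"

definition ratio_den :: "summand_data \<Rightarrow> nat \<Rightarrow> complex \<Rightarrow> (nat \<Rightarrow> complex) \<Rightarrow> complex" where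
  "ratio_den F j h Q =
     (\<Prod>x\<leftarrow>nums F. shift_den (nu F) j x h Q) * (\<Prod>x\<leftarrow>dens F. shift_num (nu F) j x h Q)"

lemma laurent_shift: "laurent v (shift_num v j x)" "laurent v (shift_den v j x)"
  unfolding shift_num_def shift_den_def
  by (intro laurent_prod laurent_one_minus laurent.intros(5) laurent_qpow_of_int laurent_vec_power)+

lemma laurent_ratio: "laurent (nu F) (ratio_num F j)" "laurent (nu F) (ratio_den F j)"
  unfolding ratio_num_def ratio_den_def
  by (intro laurent.intros(5) laurent_prod_list laurent_shift laurent_prod laurent.intros(1-3); simp)+

section \<open>Shifting the symbols (q)_x\<close>

text \<open>Cross-multiplication treats both signs of \<open>m\<close> at once: the left product is
  empty for \<open>m >= 0\<close>, the right one for \<open>m <= 0\<close>. The assumption on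
  \<open>x\<close> makes the recursion available along the whole coset.\<close>

lemma q_fact_symbol_shift:
  assumes P: "q_fact_symbol h P" and g: "\<And>n::int. qpow h (x + of_int n) \<noteq> 1"
  shows "P (x + of_int m) * (\<Prod>i\<in>{m+1..0}. 1 - qpow h (x + of_int i)) =
         P x * (\<Prod>i\<in>{1..m}. 1 - qpow h (x + of_int i))"
proof (induction m rule: int_induct[where k = 0])
  case base
  show ?case by simp
next
  have step: "P (x + of_int (i + 1)) = (1 - qpow h (x + of_int (i + 1))) * P (x + of_int i)" for i
  proof -
    have "qpow h (x + of_int i + 1) \<noteq> 1" using g[of "i + 1"] by (simp add: add.assoc)
    then have "P (x + of_int i + 1) = (1 - qpow h (x + of_int i + 1)) * P (x + of_int i)"
      using P unfolding q_fact_symbol_def by blast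
    then show ?thesis by (simp add: add.assoc)
  qed
  {
    case (step1 i)
    have "{1..i+1} = insert (i+1) {1..i}" using step1 by auto
    then show ?case using step1 step[of i] by simp
  next
    \<comment> \<open>Going down from \<open>i\<close> to \<open>i - 1\<close> moves the factor with
      index \<open>i\<close> out of \<open>P (x + of_int i)\<close> into the left product.\<close>
    case (step2 i)
    have "{i-1+1..0} = insert i {i+1..0}" "{1..i} = {}" "{1..i-1} = {}" using step2 by auto
    then show ?case using step2 step[of "i-1"] by (simp add: mult_ac)
  }
qed

lemma idot_shift: "j \<le> v \<Longrightarrow> idot v p (k(j := k j + 1)) = idot v p k + of_int (p j)"
  by (simp add: idot_def sum.remove[of "{..v}" j] algebra_simps)

lemma shift_num_qpow: "shift_num v j (p, r) h (\<lambda>i. qpow h (k i)) =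
    (\<Prod>i\<in>{1..p j}. 1 - qpow h (idot v p k + of_int r + of_int i))"
  and shift_den_qpow: "shift_den v j (p, r) h (\<lambda>i. qpow h (k i)) =
    (\<Prod>i\<in>{p j + 1..0}. 1 - qpow h (idot v p k + of_int r + of_int i))"
  by (simp_all add: shift_num_def shift_den_def vec_power_qpow qpow_add mult_ac)

lemma shift_symbol:
  assumes P: "q_fact_symbol h P" and j: "j \<le> v"
    and g: "nonzero_vec v p \<Longrightarrow> \<forall>n::int. qpow h (idot v p k + of_int n) \<noteq> 1"
  shows "P (idot v p (k(j := k j + 1)) + of_int r) * shift_den v j (p, r) h (\<lambda>i. qpow h (k i)) =
         P (idot v p k + of_int r) * shift_num v j (p, r) h (\<lambda>i. qpow h (k i))"
    and "shift_den v j (p, r) h (\<lambda>i. qpow h (k i)) \<noteq> 0"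
    and "shift_num v j (p, r) h (\<lambda>i. qpow h (k i)) \<noteq> 0"
proof -
  let ?x = "idot v p k + of_int r"
  \<comment> \<open>Either all factors are nonzero by genericity, with \<open>r\<close> absorbed
    into the integer \<open>n\<close>, or \<open>p\<close> vanishes and both products are
    empty.\<close>
  have *: "(nonzero_vec v p \<and> (\<forall>n::int. qpow h (?x + of_int n) \<noteq> 1)) \<or> (\<not> nonzero_vec v p \<and> p j = 0)"
  proof (cases "nonzero_vec v p")
    case True
    have "qpow h (?x + of_int n) \<noteq> 1" for n :: int
      using spec[OF g[OF True], of "r + n"] by (simp add: add.assoc)
    with True show ?thesis by blast
  qed (use j in \<open>auto simp: nonzero_vec_def\<close>)
  have e: "idot v p (k(j := k j + 1)) + of_int r = ?x + of_int (p j)"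
    using idot_shift[OF j] by simp
  show "P (idot v p (k(j := k j + 1)) + of_int r) * shift_den v j (p, r) h (\<lambda>i. qpow h (k i)) =
        P ?x * shift_num v j (p, r) h (\<lambda>i. qpow h (k i))"
    unfolding e shift_num_qpow shift_den_qpow
    using * q_fact_symbol_shift[OF P, of ?x "p j"] by auto
  show "shift_den v j (p, r) h (\<lambda>i. qpow h (k i)) \<noteq> 0"
    "shift_num v j (p, r) h (\<lambda>i. qpow h (k i)) \<noteq> 0"
    unfolding shift_num_qpow shift_den_qpow using * by (auto simp: eq_commute[of 1])
qed

lemma shift_symbols:
  assumes "q_fact_symbol h P" and "j \<le> v"
    and "\<forall>(p, r)\<in>set xs. nonzero_vec v p \<longrightarrow> (\<forall>n::int. qpow h (idot v p k + of_int n) \<noteq> 1)"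
  shows "(\<Prod>(p, r)\<leftarrow>xs. P (idot v p (k(j := k j + 1)) + of_int r)) *
           (\<Prod>x\<leftarrow>xs. shift_den v j x h (\<lambda>i. qpow h (k i))) =
         (\<Prod>(p, r)\<leftarrow>xs. P (idot v p k + of_int r)) * (\<Prod>x\<leftarrow>xs. shift_num v j x h (\<lambda>i. qpow h (k i)))
       \<and> (\<Prod>x\<leftarrow>xs. shift_den v j x h (\<lambda>i. qpow h (k i))) \<noteq> 0
       \<and> (\<Prod>x\<leftarrow>xs. shift_num v j x h (\<lambda>i. qpow h (k i))) \<noteq> 0
       \<and> (\<Prod>(p, r)\<leftarrow>xs. P (idot v p k + of_int r)) \<noteq> 0"
  using assms(3)
proof (induction xs)
  case (Cons x xs)
  obtain p r where x: "x = (p, r)" by fastforce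
  have P: "P (idot v p k + of_int r) \<noteq> 0" using assms(1) by (simp add: q_fact_symbol_def)
  have "nonzero_vec v p \<Longrightarrow> \<forall>n::int. qpow h (idot v p k + of_int n) \<noteq> 1"
    using Cons.prems by (auto simp: x)
  note head = shift_symbol[OF assms(1,2) this, of r]
  have mix: "(a * e) * (b * f) = (c * g) * (d * i)" if "a * b = c * d" "e * f = g * i"
    for a b c d e f g i :: complex
    using arg_cong2[OF that, of "(*)"] by (simp only: mult_ac)
  have tail: "\<forall>(p, r)\<in>set xs. nonzero_vec v p \<longrightarrow> (\<forall>n::int. qpow h (idot v p k + of_int n) \<noteq> 1)"
    using Cons.prems by simp
  have IH: "(\<Prod>(p, r)\<leftarrow>xs. P (idot v p (k(j := k j + 1)) + of_int r)) *
           (\<Prod>x\<leftarrow>xs. shift_den v j x h (\<lambda>i. qpow h (k i))) =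
         (\<Prod>(p, r)\<leftarrow>xs. P (idot v p k + of_int r)) * (\<Prod>x\<leftarrow>xs. shift_num v j x h (\<lambda>i. qpow h (k i)))"
       "(\<Prod>x\<leftarrow>xs. shift_den v j x h (\<lambda>i. qpow h (k i))) \<noteq> 0"
       "(\<Prod>x\<leftarrow>xs. shift_num v j x h (\<lambda>i. qpow h (k i))) \<noteq> 0"
       "(\<Prod>(p, r)\<leftarrow>xs. P (idot v p k + of_int r)) \<noteq> 0"
    using Cons.IH tail by blast+
  show ?case
    unfolding x list.map prod_list.Cons case_prod_conv
    using mix[OF head(1) IH(1)] head(2,3) IH(2-4) P by simp
qed simp

section \<open>Shifting the exponent, and the ratio as an explicit fraction\<close>

text \<open>The discrete counterpart of differentiating the quadratic form: symmetry merges the two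
  cross terms. The extra diagonal term contributes only a power of q independent of
  \<open>k\<close>, which becomes 1 at q = 1.\<close>

lemma quadratic_shift:
  fixes a :: "nat \<Rightarrow> nat \<Rightarrow> complex"
  assumes j: "j \<le> v" and sym: "\<And>i. i \<le> v \<Longrightarrow> a j i = a i j"
  shows "(\<Sum>i\<le>v. \<Sum>l\<le>v. a i l * (k(j := k j + 1)) i * (k(j := k j + 1)) l) =
         (\<Sum>i\<le>v. \<Sum>l\<le>v. a i l * k i * k l) + 2 * (\<Sum>i\<le>v. a i j * k i) + a j j"
proof -
  let ?d = "\<lambda>i. if i = j then 1 else 0 :: complex"
  have "(k(j := k j + 1)) i = k i + ?d i" for i by simp
  then have "(\<Sum>i\<le>v. \<Sum>l\<le>v. a i l * (k(j := k j + 1)) i * (k(j := k j + 1)) l) =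
      (\<Sum>i\<le>v. \<Sum>l\<le>v. a i l * k i * k l + a i l * k i * ?d l + ?d i * (a i l * k l) + ?d i * (a i l * ?d l))"
    by (intro sum.cong refl) (simp only: ring_distribs mult_ac add_ac)
  also have "\<dots> = (\<Sum>i\<le>v. \<Sum>l\<le>v. a i l * k i * k l) + (\<Sum>i\<le>v. a i j * k i) + (\<Sum>l\<le>v. a j l * k l) + a j j"
    using j by (simp add: sum.distrib flip: sum_distrib_left)
      (simp add: if_distrib[where f = "\<lambda>x. _ * x"] if_distrib[where f = "\<lambda>x. x * _"] cong: if_cong)
  also have "(\<Sum>l\<le>v. a j l * k l) = (\<Sum>i\<le>v. a i j * k i)"
    using sym by (intro sum.cong) auto
  finally show ?thesis by simp
qed

lemma linear_shift:
  fixes b :: "nat \<Rightarrow> complex"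
  assumes "j \<le> v"
  shows "(\<Sum>i\<le>v. b i * (k(j := k j + 1)) i) = (\<Sum>i\<le>v. b i * k i) + b j"
  using assms by (simp add: sum.remove[of "{..v}" j] algebra_simps)

lemma ratio_is_ratio:
  assumes "summand_form F" and j: "j \<le> nu F"
  shows "ratio_is F j (ratio_num F j) (ratio_den F j)"
  unfolding ratio_is_def
proof (intro conjI laurent_ratio allI impI)
  fix h k P
  assume P: "q_fact_symbol h P"
    and g: "\<forall>(p, r)\<in>set (nums F) \<union> set (dens F). nonzero_vec (nu F) p \<longrightarrow>
           (\<forall>n::int. qpow h (idot (nu F) p k + of_int n) \<noteq> 1)"
  let ?Q = "\<lambda>i. qpow h (k i)" and ?k = "k(j := k j + 1)"
  \<comment> \<open>In \<open>A'\<close> and \<open>B'\<close> the prime marks the shifted argument;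
    in \<open>N'\<close> and \<open>D'\<close> it marks the products over
    \<open>dens\<close>.\<close>
  define A A' N D where "A = (\<Prod>(p, r)\<leftarrow>nums F. P (idot (nu F) p k + of_int r))"
    and "A' = (\<Prod>(p, r)\<leftarrow>nums F. P (idot (nu F) p ?k + of_int r))"
    and "N = (\<Prod>x\<leftarrow>nums F. shift_num (nu F) j x h ?Q)"
    and "D = (\<Prod>x\<leftarrow>nums F. shift_den (nu F) j x h ?Q)"
  define B B' N' D' where "B = (\<Prod>(p, r)\<leftarrow>dens F. P (idot (nu F) p k + of_int r))"
    and "B' = (\<Prod>(p, r)\<leftarrow>dens F. P (idot (nu F) p ?k + of_int r))"
    and "N' = (\<Prod>x\<leftarrow>dens F. shift_num (nu F) j x h ?Q)"
    and "D' = (\<Prod>x\<leftarrow>dens F. shift_den (nu F) j x h ?Q)"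
  have n: "A' * D = A * N" "A \<noteq> 0" "N \<noteq> 0" "D \<noteq> 0"
    using shift_symbols[OF P j, of "nums F" k] g by (auto simp: A_def A'_def N_def D_def)
  have d: "B' * D' = B * N'" "B \<noteq> 0" "N' \<noteq> 0" "D' \<noteq> 0"
    using shift_symbols[OF P j, of "dens F" k] g by (auto simp: B_def B'_def N'_def D'_def)
  have AB: "A' = A * N / D" "B' = B * N' / D'"
    using n d by (simp_all add: field_simps)
  define s where "s = of_real pi * \<i> * (\<Sum>i\<le>nu F. of_nat (sgn_vec F i) * k i)"
  define e where "e = 1/2 * (\<Sum>i\<le>nu F. \<Sum>j\<le>nu F. of_int (quad F i j) * k i * k j)
             + (\<Sum>i\<le>nu F. of_rat (lin_vec F i) * k i) + of_int (cst F)"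
  define b :: complex where "b = of_rat (of_int (quad F j j) / 2 + lin_vec F j)"
  have F: "summand_fun P h F k = exp s * qpow h e * (A / B)"
    by (simp add: summand_fun_def s_def e_def A_def B_def)
  have s': "of_real pi * \<i> * (\<Sum>i\<le>nu F. of_nat (sgn_vec F i) * ?k i)
      = s + of_real pi * \<i> * of_nat (sgn_vec F j)"
    using linear_shift[OF j, of "\<lambda>i. of_nat (sgn_vec F i)" k] by (simp add: s_def ring_distribs)
  have "(\<Sum>i\<le>nu F. \<Sum>l\<le>nu F. of_int (quad F i l) * ?k i * ?k l) =
     (\<Sum>i\<le>nu F. \<Sum>l\<le>nu F. of_int (quad F i l) * k i * k l)
      + 2 * (\<Sum>i\<le>nu F. of_int (quad F i j) * k i) + of_int (quad F j j)"
    using assms(1) j by (intro quadratic_shift) (auto simp: summand_form_def)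
  then have e': "1/2 * (\<Sum>i\<le>nu F. \<Sum>j\<le>nu F. of_int (quad F i j) * ?k i * ?k j)
             + (\<Sum>i\<le>nu F. of_rat (lin_vec F i) * ?k i) + of_int (cst F)
      = e + (b + idot (nu F) (\<lambda>i. quad F i j) k)"
    using linear_shift[OF j, of "\<lambda>i. of_rat (lin_vec F i)" k]
    by (simp only: e_def b_def idot_def of_rat_add of_rat_divide of_rat_of_int_eq of_rat_numeral_eq)
      (simp add: algebra_simps)
  have F': "shift_op j (summand_fun P h F) k = exp (s + of_real pi * \<i> * of_nat (sgn_vec F j))
      * qpow h (e + (b + idot (nu F) (\<lambda>i. quad F i j) k)) * (A' / B')"
    unfolding shift_op_def summand_fun_def s' e' A'_def B'_def ..
  \<comment> \<open>The monomial in \<open>Q\<close> with exponents from column \<open>j\<close> of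
    \<open>quad F\<close> is the power of q that the cross terms produce.\<close>
  have R: "ratio_num F j h ?Q / ratio_den F j h ?Q = exp (of_real pi * \<i> * of_nat (sgn_vec F j)) *
      (qpow h b * qpow h (idot (nu F) (\<lambda>i. quad F i j) k)) * ((N * D') / (D * N'))"
    unfolding ratio_num_def ratio_den_def vec_power_qpow[symmetric]
    by (simp add: vec_power_def N_def D_def N'_def D'_def b_def)
  have "qpow h e \<noteq> 0" by (simp add: qpow_def)
  then show "shift_op j (summand_fun P h F) k / summand_fun P h F k =
        ratio_num F j h ?Q / ratio_den F j h ?Q"
    unfolding F F' R AB exp_add qpow_add using n d by (simp add: field_simps)
qed

section \<open>Evaluation of the fraction at q = 1\<close>

lemma shift_at_0: "shift_num v j x 0 w = (1 - vec_power v w (fst x)) ^ nat (fst x j)"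
  "shift_den v j x 0 w = (1 - vec_power v w (fst x)) ^ nat (- fst x j)"
  by (simp_all add: shift_num_def shift_den_def qpow_def)

lemma shift_at_0_quotient:
  assumes "j \<le> v" and "nonzero_vec v (fst x) \<Longrightarrow> vec_power v w (fst x) \<noteq> 1"
  shows "shift_num v j x 0 w = (1 - vec_power v w (fst x)) powi fst x j * shift_den v j x 0 w"
    and "shift_num v j x 0 w \<noteq> 0" and "shift_den v j x 0 w \<noteq> 0"
proof -
  \<comment> \<open>A negative exponent in \<open>powi\<close> needs a nonzero base; the base can
    vanish only where the exponent is 0.\<close>
  have "fst x j = 0 \<or> 1 - vec_power v w (fst x) \<noteq> 0"
    using assms by (auto simp: nonzero_vec_def)
  then show "shift_num v j x 0 w = (1 - vec_power v w (fst x)) powi fst x j * shift_den v j x 0 w"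
    and "shift_num v j x 0 w \<noteq> 0" and "shift_den v j x 0 w \<noteq> 0"
    unfolding shift_at_0 by (auto simp: power_int_def field_simps)
qed

lemma shift_at_0_quotients:
  assumes "j \<le> v" and "\<forall>(p, r)\<in>set xs. nonzero_vec v p \<longrightarrow> vec_power v w p \<noteq> 1"
  shows "(\<Prod>x\<leftarrow>xs. shift_num v j x 0 w) =
           (\<Prod>(p, r)\<leftarrow>xs. (1 - vec_power v w p) powi p j) * (\<Prod>x\<leftarrow>xs. shift_den v j x 0 w)
       \<and> (\<Prod>(p, r)\<leftarrow>xs. (1 - vec_power v w p) powi p j) \<noteq> 0
       \<and> (\<Prod>x\<leftarrow>xs. shift_num v j x 0 w) \<noteq> 0 \<and> (\<Prod>x\<leftarrow>xs. shift_den v j x 0 w) \<noteq> 0"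
  using assms(2)
proof (induction xs)
  case (Cons x xs)
  have "nonzero_vec v (fst x) \<Longrightarrow> vec_power v w (fst x) \<noteq> 1"
    using Cons.prems by auto
  note shift_at_0_quotient[OF assms(1) this]
  then show ?case using Cons by (simp add: case_prod_unfold)
qed simp

lemma ratio_at_0:
  assumes "regular_point F w" and j: "j \<le> nu F"
  shows "ratio_den F j 0 w \<noteq> 0" and "ratio_num F j 0 w / ratio_den F j 0 w = limit_ratio F j w"
proof -
  have "\<forall>(p, r)\<in>set (nums F). nonzero_vec (nu F) p \<longrightarrow> vec_power (nu F) w p \<noteq> 1"
    "\<forall>(p, r)\<in>set (dens F). nonzero_vec (nu F) p \<longrightarrow> vec_power (nu F) w p \<noteq> 1"
    using assms(1) by (auto simp: regular_point_def)
  note q = this[THEN shift_at_0_quotients[OF j]]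
  show "ratio_den F j 0 w \<noteq> 0" using q by (simp add: ratio_den_def)
  show "ratio_num F j 0 w / ratio_den F j 0 w = limit_ratio F j w"
    using q unfolding ratio_num_def ratio_den_def limit_ratio_def
    by (auto simp: qpow_def field_simps)
qed


section \<open>Independence of the fraction\<close>

text \<open>
  On each coset of the integers, start with the value \<open>1\<close> where the real part lies in \<open>[0, 1)\<close> and
  continue by the recursion, vanishing factors being replaced by \<open>1\<close>.
\<close>

lemma q_fact_symbol_exists: "\<exists>P. q_fact_symbol h P"
proof -
  define g where "g x = (if qpow h x = 1 then 1 else 1 - qpow h x)" for x
  define y where "y x = x - of_int \<lfloor>Re x\<rfloor>" for x :: complex
  define P where "P x = (\<Prod>i\<in>{1..\<lfloor>Re x\<rfloor>}. g (y x + of_int i)) / (\<Prod>i\<in>{\<lfloor>Re x\<rfloor>+1..0}. g (y x + of_int i))" for x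
  have g: "g x \<noteq> 0" for x by (simp add: g_def)
  have P: "P (x + 1) = g (x + 1) * P x" for x
  proof -
    define n where "n = \<lfloor>Re x\<rfloor>"
    have n: "\<lfloor>Re (x + 1)\<rfloor> = n + 1" by (simp add: n_def)
    have y: "y (x + 1) = y x" "y x + of_int (n + 1) = x + 1" by (simp_all add: y_def n_def)
    have gy: "g (y x + of_int (n + 1)) = g (x + 1)" by (simp only: y)
    show ?thesis
    proof (cases "n \<ge> 0")
      case True
      then have "{1..n+1} = insert (n+1) {1..n}" "{n+1..0} = {}" "{n+1+1..0} = {}" by auto
      then show ?thesis unfolding P_def n n_def[symmetric] y(1) by (simp add: gy del: of_int_add)
    next
      case False
      then have "{n+1..0} = insert (n+1) {n+1+1..0}" "{1..n} = {}" "{1..n+1} = {}" by auto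
      then show ?thesis unfolding P_def n n_def[symmetric] y(1) using g by (simp add: gy del: of_int_add)
    qed
  qed
  have "P x \<noteq> 0" for x using g by (simp add: P_def)
  then have "q_fact_symbol h P" unfolding q_fact_symbol_def by (simp add: P) (simp add: g_def)
  then show ?thesis by (rule exI[of _ P])
qed

section \<open>Generic values of \<open>h\<close> for fixed \<open>Q\<close>\<close>

text \<open>For nonzero \<open>c\<close>, the number \<open>h * a\<close> must be one of the
  countably many logarithms of \<open>1 / c\<close>; for \<open>c = 0\<close> there is no
  solution.\<close>

lemma countable_qpow_eq:
  assumes "a \<noteq> 0"
  shows "countable {h. qpow h a * c = 1}"
proof (cases "c = 0")
  case False
  have "{h. qpow h a * c = 1} \<subseteq> range (\<lambda>m::int. (Ln (inverse c) + (of_int (2 * m) * pi) * \<i>) / a)"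
  proof
    fix h assume "h \<in> {h. qpow h a * c = 1}"
    then have "exp (h * a) = exp (Ln (inverse c))"
      using False by (simp add: qpow_def field_simps)
    then obtain m :: int where "h * a = Ln (inverse c) + (of_int (2 * m) * pi) * \<i>"
      using exp_eq by blast
    then have "h = (Ln (inverse c) + (of_int (2 * m) * pi) * \<i>) / a"
      using assms by (simp add: field_simps)
    then show "h \<in> range (\<lambda>m::int. (Ln (inverse c) + (of_int (2 * m) * pi) * \<i>) / a)" by blast
  qed
  then show ?thesis by (rule countable_subset) auto
qed simp

text \<open>The genericity conditions in \<open>ratio_is\<close>, rewritten as conditions on
  \<open>h\<close> alone by holding each power \<open>qpow h (k i)\<close> at the value
  \<open>w i\<close>.\<close>

definition generic_at :: "summand_data \<Rightarrow> (nat \<Rightarrow> complex) \<Rightarrow> complex set" where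
  "generic_at F w = {h. generic_q h \<and> (\<forall>(p, r)\<in>set (nums F) \<union> set (dens F).
     nonzero_vec (nu F) p \<longrightarrow> (\<forall>n::int. qpow h (of_int n) * vec_power (nu F) w p \<noteq> 1))}"

text \<open>Each forbidden equation with \<open>n\<close> nonzero has countably many solutions. For
  \<open>n = 0\<close> it would read \<open>vec_power (nu F) w p = 1\<close>, which regularity rules
  out.\<close>

lemma countable_not_generic_at:
  assumes "regular_point F w"
  shows "countable (- generic_at F w)"
proof (rule countable_subset)
  let ?X = "set (nums F) \<union> set (dens F)"
  show "- generic_at F w \<subseteq> (\<Union>n\<in>{0<..}. {h. qpow h (of_nat n) * 1 = 1}) \<union>
      (\<Union>x\<in>?X. \<Union>n\<in>- {0::int}. {h. qpow h (of_int n) * vec_power (nu F) w (fst x) = 1})"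
  proof
    fix h assume "h \<in> - generic_at F w"
    then consider "\<not> generic_q h" | p r n where "(p, r) \<in> ?X" "nonzero_vec (nu F) p"
        "qpow h (of_int n) * vec_power (nu F) w p = 1"
      unfolding generic_at_def by blast
    then show "h \<in> (\<Union>n\<in>{0<..}. {h. qpow h (of_nat n) * 1 = 1}) \<union>
      (\<Union>x\<in>?X. \<Union>n\<in>- {0::int}. {h. qpow h (of_int n) * vec_power (nu F) w (fst x) = 1})"
    proof cases
      case 1
      then show ?thesis by (auto simp: generic_q_def)
    next
      case 2
      then have "vec_power (nu F) w p \<noteq> 1" using assms by (auto simp: regular_point_def)
      then have "n \<noteq> 0" using 2 by (auto simp: qpow_def)
      then show ?thesis using 2 by force
    qed
  qed
  show "countable ((\<Union>n\<in>{0<..}. {h. qpow h (of_nat n) * 1 = 1}) \<union>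
      (\<Union>x\<in>?X. \<Union>n\<in>- {0::int}. {h. qpow h (of_int n) * vec_power (nu F) w (fst x) = 1}))"
    by (intro countable_Un countable_UN countable_qpow_eq) (auto intro: countable_finite)
qed

text \<open>Discs are uncountable, so every punctured disc meets \<open>G\<close>; limits along
  \<open>G\<close> are therefore unique.\<close>

lemma at_within_co_countable_neq_bot:
  fixes G :: "complex set"
  assumes "countable (- G)"
  shows "at x within G \<noteq> bot"
  unfolding trivial_limit_within not_not islimpt_approachable
proof (intro allI impI)
  fix e :: real assume "e > 0"
  then have "uncountable (ball x e - insert x (- G))"
    using assms by (intro uncountable_minus_countable uncountable_ball) auto
  then obtain y where "y \<in> ball x e - insert x (- G)"
    by (metis countable_empty equals0I)
  then show "\<exists>y\<in>G. y \<noteq> x \<and> dist y x < e" by (auto simp: dist_commute)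
qed

text \<open>The choice \<open>k i = Ln (w i) / h\<close> gives \<open>qpow h (k i) = w i\<close>, so
  \<open>Q\<close> stays at \<open>w\<close> while \<open>h\<close> varies. The right-hand side does
  not mention the fraction.\<close>

lemma ratio_is_generic:
  assumes "ratio_is F j N D" and w: "\<And>i. i \<le> nu F \<Longrightarrow> w i \<noteq> 0" and h: "h \<in> generic_at F w"
    and P: "q_fact_symbol h P" and D: "D h w \<noteq> 0"
  shows "N h w / D h w = shift_op j (summand_fun P h F) (\<lambda>i. Ln (w i) / h) /
           summand_fun P h F (\<lambda>i. Ln (w i) / h)"
proof -
  let ?k = "\<lambda>i. Ln (w i) / h"
  have g: "generic_q h" using h by (simp add: generic_at_def)
  then have "h \<noteq> 0" by (auto simp: generic_q_def qpow_def)
  then have k: "qpow h (?k i) = w i" if "i \<le> nu F" for i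
    using w[OF that] by (simp add: qpow_def)
  have L: "laurent (nu F) N" "laurent (nu F) D" using assms(1) by (auto simp: ratio_is_def)
  \<comment> \<open>The two arguments are known to agree only up to index \<open>nu F\<close>, which
    suffices for Laurent polynomials.\<close>
  have e: "N h (\<lambda>i. qpow h (?k i)) = N h w" "D h (\<lambda>i. qpow h (?k i)) = D h w"
    by (rule laurent_cong[OF L(1)], erule k) (rule laurent_cong[OF L(2)], erule k)
  have "vec_power (nu F) w p = qpow h (idot (nu F) p ?k)" for p
    unfolding vec_power_qpow[symmetric] vec_power_def using k by (intro prod.cong) auto
  then have c: "\<forall>(p, r)\<in>set (nums F) \<union> set (dens F). nonzero_vec (nu F) p \<longrightarrow>
       (\<forall>n::int. qpow h (idot (nu F) p ?k + of_int n) \<noteq> 1)"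
    using h unfolding generic_at_def by (simp add: qpow_add mult.commute)
  have "D h (\<lambda>i. qpow h (?k i)) \<noteq> 0" using D e by simp
  note assms(1)[unfolded ratio_is_def, THEN conjunct2, THEN conjunct2, THEN spec[of _ h],
      THEN spec[of _ ?k], THEN spec[of _ P], THEN mp, OF g, THEN mp, OF P, THEN mp, OF c, THEN mp, OF this]
  then show ?thesis using e by simp
qed

lemma ratio_is_unique:
  assumes reg: "regular_point F w" and "ratio_is F j N D" and "ratio_is F j N' D'"
    and D: "D 0 w \<noteq> 0" and D': "D' 0 w \<noteq> 0"
  shows "N 0 w / D 0 w = N' 0 w / D' 0 w"
proof -
  let ?A = "at 0 within generic_at F w"
  have w: "\<And>i. i \<le> nu F \<Longrightarrow> w i \<noteq> 0" using reg by (auto simp: regular_point_def)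
  have lim: "((\<lambda>h. f h w) \<longlongrightarrow> f 0 w) ?A" if "laurent (nu F) f" for f
  proof -
    have "isCont (\<lambda>h. f h w) 0"
      using laurent_continuous[OF that, of w] by (simp add: continuous_on_eq_continuous_at)
    then show ?thesis by (rule tendsto_within_subset[OF isContD]) simp
  qed
  have "laurent (nu F) N" "laurent (nu F) D" "laurent (nu F) N'" "laurent (nu F) D'"
    using assms(2,3) by (simp_all add: ratio_is_def)
  note l = lim[OF this(2)] lim[OF this(1)] lim[OF this(4)] lim[OF this(3)]
  have quot: "((\<lambda>h. N h w / D h w) \<longlongrightarrow> N 0 w / D 0 w) ?A"
    "((\<lambda>h. N' h w / D' h w) \<longlongrightarrow> N' 0 w / D' 0 w) ?A"
    by (rule tendsto_divide[OF l(2,1) D] tendsto_divide[OF l(4,3) D'])+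
  have "\<forall>\<^sub>F h in ?A. N h w / D h w = N' h w / D' h w"
  proof -
    have "\<forall>\<^sub>F h in ?A. h \<in> generic_at F w" by (simp add: eventually_at_filter)
    then show ?thesis
      using tendsto_imp_eventually_ne[OF l(1) D] tendsto_imp_eventually_ne[OF l(3) D']
    proof eventually_elim
      case (elim h)
      \<comment> \<open>\<open>ratio_is\<close> speaks about all symbols \<open>P\<close>, so one
        must exist for it to have content; both fractions then equal the same quotient of values of
        \<open>summand_fun P h F\<close>.\<close>
      obtain P where "q_fact_symbol h P" using q_fact_symbol_exists by blast
      then show ?case
        using ratio_is_generic[OF assms(2) w, where h = h and P = P]
            ratio_is_generic[OF assms(3) w, where h = h and P = P] elim
        by simp
    qed
  qed
  with quot(1) have "((\<lambda>h. N' h w / D' h w) \<longlongrightarrow> N 0 w / D 0 w) ?A"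
    by (simp add: tendsto_cong)
  then show ?thesis
    using quot(2) at_within_co_countable_neq_bot[OF countable_not_generic_at[OF reg]]
    by (intro tendsto_unique)
qed

text \<open>Regularity keeps the denominator of the explicit fraction nonzero at q = 1, giving
  existence; \<open>ratio_is_unique\<close> makes the definite description well defined.\<close>

lemma eps_ratio_eq:
  assumes "summand_form F" and "regular_point F w" and "j \<le> nu F"
  shows "eps_ratio F j w = limit_ratio F j w"
  unfolding eps_ratio_def
proof (rule the_equality)
  show "\<exists>N D. ratio_is F j N D \<and> D 0 w \<noteq> 0 \<and> limit_ratio F j w = N 0 w / D 0 w"
    using ratio_is_ratio[OF assms(1,3)] ratio_at_0[OF assms(2,3)] by metis
  then show "z = limit_ratio F j w"
    if "\<exists>N D. ratio_is F j N D \<and> D 0 w \<noteq> 0 \<and> z = N 0 w / D 0 w" for z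
    using that ratio_is_unique[OF assms(2)] by metis
qed

theorem proposition1p7:
  fixes F :: summand_data and S :: "nat \<Rightarrow> (nat \<Rightarrow> complex) set" and K :: braid
    and w :: "nat \<Rightarrow> complex" and \<Phi> :: "(nat \<Rightarrow> complex) \<Rightarrow> complex"
  assumes "is_knot K"
    and "summand_form F"
    and "is_summand_of F S K"
    and "regular_point F w"
    and "potential_branch F w \<Phi>"
  shows "(\<forall>j\<in>{1..nu F}. exp (w j * partial_deriv j \<Phi> w) = eps_ratio F j w) \<and>
         exp (w 0 * partial_deriv 0 \<Phi> w) = eps_ratio F 0 w \<and>
         (\<forall>l. ((\<forall>j\<in>{1..nu F}. exp (w j * partial_deriv j \<Phi> w) = 1) \<and>
                exp (w 0 * partial_deriv 0 \<Phi> w) = l\<^sup>2)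
           \<longleftrightarrow> ((\<forall>j\<in>{1..nu F}. eps_ratio F j w = 1) \<and> eps_ratio F 0 w = l\<^sup>2))"
proof -
  \<comment> \<open>Both sides meet in \<open>limit_ratio F j w\<close>. The index 0 is included, so
    the equation for \<alpha> is matched in the same way.\<close>
  have "exp (w j * partial_deriv j \<Phi> w) = eps_ratio F j w" if "j \<le> nu F" for j
    using exp_partial_deriv_potential eps_ratio_eq assms that by simp
  then show ?thesis by simp
qed

end
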